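(* Let $G$ be a connected graph with at least one edge, with adjacency matrix $(a_{uv})$, let $\lambda=\lambda(G)$, let $\boldsymbol{x}=(x_v)$ be its positive unit Perron vector and put $\pi_v=x_v^2$. Let $(X_t)_{t\ge1}$ be the Markov chain on $V(G)$ with initial distribution $\pi$ and transition matrix $P_{uv}=a_{uv}x_v/(\lambda x_u)$, let $\mu_\ell$ be the distribution of $(X_1,\dots,X_\ell)$, and let $\nu_\ell$ be the uniform distribution on the set of walks on $\ell$ vertices of $G$. Define probability distributions on the ordered pairs $(u,v)$ with $u,v\in V(G)$ by $$Q_{uv}=\frac{a_{uv}x_ux_v}{\lambda},\qquad R_{uv}=\frac{a_{uv}\pi_u\pi_v}{\Phi_G(\pi)}.$$ Then for every integer $\ell\ge1$, $$\log w_\ell(G)=\ell\log\lambda-\log\Phi_G(\pi)+D(Q\,\Vert\,R)+D(\mu_\ell\,\Vert\,\nu_\ell).$$ In particular, $$\lambda(G)^\ell\ \le\ \Phi_G(\pi)\cdot w_\ell(G),$$ with equality if and only if $Q=R$ and $\mu_\ell=\nu_\ell$.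
   Context: All graphs are finite and simple; $\log=\log_2$. $\lambda(G)$ is the spectral radius of the adjacency matrix of $G$. The positive unit Perron vector is the eigenvector for $\lambda(G)$ with positive entries and Euclidean norm $1$. $\Phi_G(\pi):=2\sum_{uv\in E(G)}\pi_u\pi_v=\sum_{u,v\in V(G)}a_{uv}\pi_u\pi_v$. A walk on $\ell$ vertices is a sequence $(v_1,\dots,v_\ell)$ of not necessarily distinct vertices with $v_iv_{i+1}\in E(G)$ for $1\le i\le\ell-1$, and $w_\ell(G)$ is the number of them. For probability vectors $q,s$ on the same finite set with $s(a)>0$ whenever $q(a)>0$, the relative entropy is $D(q\,\Vert\,s)=\sum_a q(a)\log\frac{q(a)}{s(a)}$, the sum being over $a$ with $q(a)>0$. *)

theory Defs
  imports
    "HOL-Probability.Probability"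
    "Graph_Theory.Graph_Theory"
    "Jordan_Normal_Form.Spectral_Radius"
begin

text \<open>
  A finite simple graph is a \<open>pair_graph\<close>: a finite, loop-free, symmetric digraph whose arcs
  are pairs of vertices, so that an edge \<open>uv\<close> appears as the two arcs \<open>(u, v)\<close> and \<open>(v, u)\<close>.
\<close>

definition adj :: "'a pair_pre_digraph \<Rightarrow> 'a \<Rightarrow> 'a \<Rightarrow> real" where
  "adj G u v = (if (u, v) \<in> parcs G then 1 else 0)"

text \<open>
  Matrices are indexed by natural numbers, so the vertices have to be listed in some order;
  the spectrum does not depend on that order.
\<close>

definition adjacency_mat :: "'a pair_pre_digraph \<Rightarrow> 'a list \<Rightarrow> complex mat" where
  "adjacency_mat G vs =
     mat (length vs) (length vs) (\<lambda>(i, j). complex_of_real (adj G (vs ! i) (vs ! j)))"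

definition graph_spectral_radius :: "'a pair_pre_digraph \<Rightarrow> real" where
  "graph_spectral_radius G =
     spectral_radius (adjacency_mat G (SOME vs. distinct vs \<and> set vs = pverts G))"

text \<open>Values of \<open>x\<close> outside the vertex set are irrelevant here and below.\<close>

definition perron_vector :: "'a pair_pre_digraph \<Rightarrow> ('a \<Rightarrow> real) \<Rightarrow> bool" where
  "perron_vector G x \<longleftrightarrow>
     (\<forall>u\<in>pverts G. (\<Sum>v\<in>pverts G. adj G u v * x v) = graph_spectral_radius G * x u) \<and>
     (\<forall>v\<in>pverts G. x v > 0) \<and>
     sqrt (\<Sum>v\<in>pverts G. (x v)\<^sup>2) = 1"

text \<open>Summing over ordered pairs counts every edge twice, which is the factor 2 in
  \<open>2 \<Sum>\<^bsub>uv \<in> E\<^esub> p\<^sub>u p\<^sub>v\<close>.\<close>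

definition edge_form :: "'a pair_pre_digraph \<Rightarrow> ('a \<Rightarrow> real) \<Rightarrow> real" where
  "edge_form G p = (\<Sum>u\<in>pverts G. \<Sum>v\<in>pverts G. adj G u v * p u * p v)"

text \<open>The parameter \<open>l\<close> is the number of vertices of the walk, not of its steps.\<close>

definition walks :: "'a pair_pre_digraph \<Rightarrow> nat \<Rightarrow> 'a list set" where
  "walks G l = {p. vwalk p (with_proj G) \<and> length p = l}"

definition num_walks :: "'a pair_pre_digraph \<Rightarrow> nat \<Rightarrow> nat" where
  "num_walks G l = card (walks G l)"

definition vertex_seqs :: "'a pair_pre_digraph \<Rightarrow> nat \<Rightarrow> 'a list set" where
  "vertex_seqs G l = {p. set p \<subseteq> pverts G \<and> length p = l}"

text \<open>
  Time starts at 1. The transition law is only required conditionally on histories of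
  positive probability.
\<close>

definition markov_chain ::
  "'b measure \<Rightarrow> 'a set \<Rightarrow> ('a \<Rightarrow> real) \<Rightarrow> ('a \<Rightarrow> 'a \<Rightarrow> real) \<Rightarrow> (nat \<Rightarrow> 'b \<Rightarrow> 'a) \<Rightarrow> bool" where
  "markov_chain M V init P X \<longleftrightarrow>
     prob_space M \<and>
     (\<forall>t\<ge>1. X t \<in> measurable M (count_space V)) \<and>
     (\<forall>v\<in>V. \<P>(\<omega> in M. X 1 \<omega> = v) = init v) \<and>
     (\<forall>t\<ge>1. \<forall>h. \<forall>v\<in>V. \<P>(\<omega> in M. \<forall>i\<in>{1..t}. X i \<omega> = h i) > 0 \<longrightarrow>
        \<P>(\<omega> in M. X (t + 1) \<omega> = v \<bar> \<forall>i\<in>{1..t}. X i \<omega> = h i) = P (h t) v)"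

definition path_law :: "'b measure \<Rightarrow> (nat \<Rightarrow> 'b \<Rightarrow> 'a) \<Rightarrow> nat \<Rightarrow> 'a list \<Rightarrow> real" where
  "path_law M X l p = \<P>(\<omega> in M. map (\<lambda>t. X t \<omega>) [1..<l + 1] = p)"

definition prob_vector :: "'c set \<Rightarrow> ('c \<Rightarrow> real) \<Rightarrow> bool" where
  "prob_vector A q \<longleftrightarrow> (\<forall>a\<in>A. q a \<ge> 0) \<and> (\<Sum>a\<in>A. q a) = 1"

text \<open>
  The value of \<open>relative_entropy\<close> is meaningful only under the side condition
  \<open>relative_entropy_defined\<close>, as division by zero and the logarithm of zero are total.
\<close>

definition relative_entropy_defined :: "'c set \<Rightarrow> ('c \<Rightarrow> real) \<Rightarrow> ('c \<Rightarrow> real) \<Rightarrow> bool" where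
  "relative_entropy_defined A q s \<longleftrightarrow>
     finite A \<and> prob_vector A q \<and> prob_vector A s \<and> (\<forall>a\<in>A. q a > 0 \<longrightarrow> s a > 0)"

definition relative_entropy :: "'c set \<Rightarrow> ('c \<Rightarrow> real) \<Rightarrow> ('c \<Rightarrow> real) \<Rightarrow> real" where
  "relative_entropy A q s = (\<Sum>a\<in>{a \<in> A. q a > 0}. q a * log 2 (q a / s a))"

end

theory Submission
  imports Defs
begin

text \<open>
  The transition probabilities of the chain telescope: a walk \<open>v\<^sub>1, \<dots>, v\<^sub>l\<close> is followed with
  probability \<open>\<pi>(v\<^sub>1) \<Prod>\<^sub>i x(v\<^sub>i\<^sub>+\<^sub>1) / (\<lambda> x(v\<^sub>i)) = x(v\<^sub>1) x(v\<^sub>l) / \<lambda>\<^sup>l\<^sup>-\<^sup>1\<close>, which depends on its two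
  endpoints only (\<open>path_law_eq_path_weight\<close>). The density of \<open>\<mu>\<^sub>l\<close> with respect to the uniform
  distribution is therefore \<open>w\<^sub>l x(v\<^sub>1) x(v\<^sub>l) / \<lambda>\<^sup>l\<^sup>-\<^sup>1\<close>. The chain is stationary, so both endpoints
  have distribution \<open>\<pi>\<close> (\<open>sum_path_weight_hd\<close>, \<open>sum_path_weight_last\<close>), and
  \<open>D(\<mu>\<^sub>l \<parallel> \<nu>\<^sub>l) = log w\<^sub>l - (l - 1) log \<lambda> + 2 \<Sum>\<^sub>v \<pi>(v) log x(v)\<close>.
  The distribution \<open>Q\<close> also has both marginals equal to \<open>\<pi>\<close>, and its density with respect to \<open>R\<close> is
  \<open>\<Phi>(\<pi>) / (\<lambda> x(u) x(v))\<close>, whence \<open>D(Q \<parallel> R) = log \<Phi>(\<pi>) - log \<lambda> - 2 \<Sum>\<^sub>v \<pi>(v) log x(v)\<close>.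
  In the sum of the two divergences the terms with \<open>log x\<close> cancel, which is the identity. The
  inequality and its equality case are Gibbs' inequality applied to both divergences.

  The computation is carried out for a symmetric nonnegative matrix \<open>a\<close>, with every sequence of
  vertices weighted by the product of the entries along it; for an adjacency matrix this product is
  the indicator function of the walks, and \<open>w\<^sub>l\<close> is the total weight of the sequences of length \<open>l\<close>.
\<close>

section \<open>Gibbs' inequality\<close>

lemma relative_entropy_eq_sum:
  assumes "relative_entropy_defined A q s"
  shows "relative_entropy A q s = (\<Sum>a\<in>A. q a * log 2 (q a / s a))"
  unfolding relative_entropy_def
  using assms
  by (intro sum.mono_neutral_left)
    (auto simp: relative_entropy_defined_def prob_vector_def not_less antisym)

text \<open>
  This is \<open>ln t \<le> t - 1\<close> at \<open>t = s a / q a\<close>, averaged with respect to \<open>q\<close>. The logarithmic bound is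
  strict unless \<open>t = 1\<close>, so equality forces \<open>s = q\<close> on the support of \<open>q\<close>; there \<open>s\<close> then has its
  whole mass already, and it vanishes elsewhere.
\<close>
lemma relative_entropy_nonneg_and_eq_0_iff:
  assumes d: "relative_entropy_defined A q s"
  shows relative_entropy_nonneg: "0 \<le> relative_entropy A q s"
    and relative_entropy_eq_0_iff: "relative_entropy A q s = 0 \<longleftrightarrow> (\<forall>a\<in>A. q a = s a)"
proof -
  define S where "S = {a \<in> A. q a > 0}"
  have fin: "finite A" "finite S" and SA: "S \<subseteq> A"
    using d by (auto simp: relative_entropy_defined_def S_def)
  have q0: "q a \<ge> 0" and s0: "s a \<ge> 0" if "a \<in> A" for a
    using d that by (auto simp: relative_entropy_defined_def prob_vector_def)
  have sums: "sum q A = 1" "sum s A = 1"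
    using d by (auto simp: relative_entropy_defined_def prob_vector_def)
  have pos: "q a > 0" "s a > 0" if "a \<in> S" for a
    using d that by (auto simp: relative_entropy_defined_def S_def)
  have qS: "sum q S = 1"
    using sums(1) fin SA q0
    by (subst sum.mono_neutral_left[of A S]) (auto simp: S_def not_less antisym)
  have sS: "sum s S \<le> 1"
    using sum_mono2[OF fin(1) SA, of s] s0 sums(2) by auto
  \<comment> \<open>the loss incurred in the logarithmic bound at each point of the support\<close>
  define e where "e a = q a * ln (q a / s a) - (q a - s a)" for a
  have e_eq: "e a = q a * (s a / q a - 1 - ln (s a / q a))" if "a \<in> S" for a
    using pos[OF that] by (simp add: e_def ln_div algebra_simps)
  have e0: "e a \<ge> 0" if "a \<in> S" for a
    using pos[OF that] ln_le_minus_one[of "s a / q a"] unfolding e_eq[OF that]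
    by (intro mult_nonneg_nonneg) auto
  have e_eq_0: "q a = s a" if "a \<in> S" "e a = 0" for a
    using pos[OF that(1)] ln_eq_minus_one[of "s a / q a"] that by (auto simp: e_eq)
  have H: "relative_entropy A q s * ln 2 = (1 - sum s S) + sum e S"
    unfolding relative_entropy_def S_def[symmetric] e_def
    by (simp add: sum_distrib_right log_def sum_subtractf qS)
  have eS: "sum e S \<ge> 0"
    using e0 by (rule sum_nonneg)
  have "0 \<le> relative_entropy A q s * ln 2"
    unfolding H using sS eS by simp
  then show "0 \<le> relative_entropy A q s"
    by (simp add: zero_le_mult_iff)
  show "relative_entropy A q s = 0 \<longleftrightarrow> (\<forall>a\<in>A. q a = s a)"
  proof
    assume "relative_entropy A q s = 0"
    then have z: "sum s S = 1" "sum e S = 0"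
      using H sS eS by auto
    have "\<forall>a\<in>S. e a = 0"
      using z(2) e0 fin(2) by (subst (asm) sum_nonneg_eq_0_iff) auto
    then have on: "\<forall>a\<in>S. q a = s a"
      using e_eq_0 by blast
    have "sum s (A - S) = 0"
      using sum_diff[OF fin(1) SA, of s] z(1) sums(2) by simp
    then have "\<forall>a\<in>A - S. s a = 0"
      using s0 fin(1) by (subst (asm) sum_nonneg_eq_0_iff) auto
    moreover have "\<forall>a\<in>A - S. q a = 0"
      using q0 by (auto simp: S_def not_less antisym)
    ultimately show "\<forall>a\<in>A. q a = s a"
      using on by (metis DiffI)
  next
    assume "\<forall>a\<in>A. q a = s a"
    then show "relative_entropy A q s = 0"
      by (auto simp: relative_entropy_def intro!: sum.neutral)
  qed
qed

section \<open>Sequences over a finite set\<close>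

lemma sum_lists_Suc_snoc:
  "(\<Sum>p | set p \<subseteq> V \<and> length p = Suc n. f p) =
    (\<Sum>p | set p \<subseteq> V \<and> length p = n. \<Sum>v\<in>V. f (p @ [v]))"
proof -
  let ?L = "\<lambda>n. {p. set p \<subseteq> V \<and> length p = n}"
  have "bij_betw (\<lambda>(p, v). p @ [v]) (?L n \<times> V) (?L (Suc n))"
  proof (rule bij_betw_imageI)
    show "(\<lambda>(p, v). p @ [v]) ` (?L n \<times> V) = ?L (Suc n)"
    proof (intro equalityI subsetI)
      fix p assume p: "p \<in> ?L (Suc n)"
      then obtain q v where "p = q @ [v]"
        by (cases p rule: rev_exhaust) auto
      with p show "p \<in> (\<lambda>(p, v). p @ [v]) ` (?L n \<times> V)"
        by force
    qed auto
  qed (auto simp: inj_on_def)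
  from sum.reindex_bij_betw[OF this, of f] show ?thesis
    by (simp add: sum.cartesian_product case_prod_unfold)
qed

fun edge_product :: "('a \<Rightarrow> 'a \<Rightarrow> real) \<Rightarrow> 'a list \<Rightarrow> real" where
  "edge_product a [] = 1"
| "edge_product a [u] = 1"
| "edge_product a (u # v # p) = a u v * edge_product a (v # p)"

lemma edge_product_snoc:
  "p \<noteq> [] \<Longrightarrow> edge_product a (p @ [v]) = edge_product a p * a (last p) v"
  by (induction a p rule: edge_product.induct) auto

lemma edge_product_nonneg:
  "(\<And>u v. u \<in> set p \<Longrightarrow> v \<in> set p \<Longrightarrow> a u v \<ge> 0) \<Longrightarrow> edge_product a p \<ge> 0"
  by (induction a p rule: edge_product.induct) auto

section \<open>The path measure of a positive eigenvector\<close>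

text \<open>
  In the theorem \<open>a\<close> is an adjacency matrix, \<open>x\<close> its Perron vector and \<open>lam\<close> its spectral radius.
\<close>
locale positive_eigenvector =
  fixes V :: "'a set" and a :: "'a \<Rightarrow> 'a \<Rightarrow> real" and lam :: real and x :: "'a \<Rightarrow> real"
  assumes finite_V: "finite V"
    and a_nonneg: "u \<in> V \<Longrightarrow> v \<in> V \<Longrightarrow> a u v \<ge> 0"
    and a_sym: "u \<in> V \<Longrightarrow> v \<in> V \<Longrightarrow> a u v = a v u"
    and eigen: "u \<in> V \<Longrightarrow> (\<Sum>v\<in>V. a u v * x v) = lam * x u"
    and x_pos: "v \<in> V \<Longrightarrow> x v > 0"
    and x_norm: "(\<Sum>v\<in>V. (x v)\<^sup>2) = 1"
    and lam_pos: "lam > 0"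
begin

abbreviation seqs :: "nat \<Rightarrow> 'a list set" where
  "seqs l \<equiv> {p. set p \<subseteq> V \<and> length p = l}"

text \<open>The telescoped probability that the chain follows the path \<open>p\<close>.\<close>
definition path_weight :: "'a list \<Rightarrow> real" where
  "path_weight p = edge_product a p * x (hd p) * x (last p) / lam ^ (length p - 1)"

definition total_weight :: "nat \<Rightarrow> real" where
  "total_weight l = (\<Sum>p\<in>seqs l. edge_product a p)"

definition form :: real where
  "form = (\<Sum>u\<in>V. \<Sum>v\<in>V. a u v * (x u)\<^sup>2 * (x v)\<^sup>2)"

lemma finite_seqs: "finite (seqs l)"
  using finite_lists_length_eq[OF finite_V] .

lemma hd_last_in_V:
  assumes "p \<in> seqs l" "l \<ge> 1"
  shows "hd p \<in> V" "last p \<in> V"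
proof -
  have "p \<noteq> []" using assms by auto
  then show "hd p \<in> V" "last p \<in> V"
    using assms(1) hd_in_set[of p] last_in_set[of p] by auto
qed

lemma path_weight_single: "path_weight [v] = (x v)\<^sup>2"
  by (simp add: path_weight_def power2_eq_square)

lemma path_weight_snoc:
  assumes "p \<noteq> []" "set p \<subseteq> V"
  shows "path_weight (p @ [v]) = path_weight p * (a (last p) v * x v / (lam * x (last p)))"
proof -
  have "x (last p) > 0"
    using assms by (intro x_pos) auto
  moreover have "lam ^ length p = lam * lam ^ (length p - 1)"
    using assms by (cases p) auto
  ultimately show ?thesis
    using assms lam_pos by (simp add: path_weight_def edge_product_snoc mult_ac)
qed

lemma edge_product_a_nonneg: "p \<in> seqs l \<Longrightarrow> edge_product a p \<ge> 0"
  using a_nonneg by (intro edge_product_nonneg) auto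

lemma path_weight_nonneg: "p \<in> seqs l \<Longrightarrow> l \<ge> 1 \<Longrightarrow> path_weight p \<ge> 0"
  using x_pos[OF hd_last_in_V(1)] x_pos[OF hd_last_in_V(2)] lam_pos edge_product_a_nonneg[of p l]
  unfolding path_weight_def by (intro divide_nonneg_nonneg mult_nonneg_nonneg) (auto intro: less_imp_le)

lemma sum_transition:
  assumes "u \<in> V"
  shows "(\<Sum>v\<in>V. a u v * x v / (lam * x u)) = 1"
  using eigen[OF assms] x_pos[OF assms] lam_pos by (simp flip: sum_divide_distrib)

lemma sum_path_weight_hd:
  "(\<Sum>p\<in>seqs (Suc n). path_weight p * f (hd p)) = (\<Sum>v\<in>V. (x v)\<^sup>2 * f v)"
proof (induction n)
  case 0
  have "seqs 0 = {[]}" by auto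
  then show ?case
    by (subst sum_lists_Suc_snoc) (simp add: path_weight_single)
next
  case (Suc n)
  have "(\<Sum>v\<in>V. path_weight (p @ [v]) * f (hd (p @ [v]))) = path_weight p * f (hd p)"
    if "p \<in> seqs (Suc n)" for p
  proof -
    from that have p: "p \<noteq> []" "set p \<subseteq> V" "last p \<in> V"
      using hd_last_in_V(2)[OF that] by auto
    have "(\<Sum>v\<in>V. path_weight (p @ [v]) * f (hd (p @ [v]))) =
        path_weight p * f (hd p) * (\<Sum>v\<in>V. a (last p) v * x v / (lam * x (last p)))"
      unfolding sum_distrib_left using p by (intro sum.cong) (auto simp: path_weight_snoc)
    then show ?thesis
      using p(3) by (simp add: sum_transition)
  qed
  then show ?case
    by (subst sum_lists_Suc_snoc) (simp add: Suc.IH)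
qed

text \<open>
  The flow \<open>a u v * x u * x v / lam\<close> through a pair is symmetric in \<open>u\<close> and \<open>v\<close>, so the chain is
  reversible and the square of \<open>x\<close> is stationary.
\<close>
lemma stationary:
  "(\<Sum>u\<in>V. (x u)\<^sup>2 * (\<Sum>v\<in>V. a u v * x v / (lam * x u) * f v)) = (\<Sum>v\<in>V. (x v)\<^sup>2 * f v)"
proof -
  have "(\<Sum>u\<in>V. (x u)\<^sup>2 * (\<Sum>v\<in>V. a u v * x v / (lam * x u) * f v)) =
      (\<Sum>u\<in>V. \<Sum>v\<in>V. a v u * x u * (x v / lam * f v))"
    unfolding sum_distrib_left using x_pos lam_pos
    by (intro sum.cong refl) (force simp: power2_eq_square field_simps a_sym)
  also have "\<dots> = (\<Sum>v\<in>V. (\<Sum>u\<in>V. a v u * x u) * (x v / lam * f v))"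
    unfolding sum_distrib_right by (rule sum.swap)
  also have "\<dots> = (\<Sum>v\<in>V. (x v)\<^sup>2 * f v)"
    using lam_pos by (intro sum.cong) (auto simp: eigen power2_eq_square)
  finally show ?thesis .
qed

lemma sum_path_weight_last:
  "(\<Sum>p\<in>seqs (Suc n). path_weight p * f (last p)) = (\<Sum>v\<in>V. (x v)\<^sup>2 * f v)"
proof (induction n arbitrary: f)
  case 0
  have "seqs 0 = {[]}" by auto
  then show ?case
    by (subst sum_lists_Suc_snoc) (simp add: path_weight_single)
next
  case (Suc n)
  have "(\<Sum>v\<in>V. path_weight (p @ [v]) * f (last (p @ [v]))) =
      path_weight p * (\<Sum>v\<in>V. a (last p) v * x v / (lam * x (last p)) * f v)"
    if "p \<in> seqs (Suc n)" for p
    unfolding sum_distrib_left using that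
    by (intro sum.cong refl) (subst path_weight_snoc, auto)
  then have "(\<Sum>p\<in>seqs (Suc (Suc n)). path_weight p * f (last p)) =
      (\<Sum>p\<in>seqs (Suc n). path_weight p *
        (\<Sum>v\<in>V. a (last p) v * x v / (lam * x (last p)) * f v))"
    unfolding sum_lists_Suc_snoc[of _ V "Suc n"] by (rule sum.cong[OF refl])
  then show ?case
    by (simp only: Suc.IH[of "\<lambda>u. \<Sum>v\<in>V. a u v * x v / (lam * x u) * f v"] stationary)
qed

lemma sum_path_weight: "l \<ge> 1 \<Longrightarrow> sum path_weight (seqs l) = 1"
  using sum_path_weight_hd[where n = "l - 1" and f = "\<lambda>_. 1"] by (simp add: x_norm)

lemma total_weight_pos:
  assumes "l \<ge> 1"
  shows "total_weight l > 0"
proof -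
  have "total_weight l \<noteq> 0"
  proof
    assume "total_weight l = 0"
    then have "\<forall>p\<in>seqs l. edge_product a p = 0"
      using edge_product_a_nonneg finite_seqs unfolding total_weight_def by (subst (asm) sum_nonneg_eq_0_iff) auto
    then have "sum path_weight (seqs l) = 0"
      by (intro sum.neutral) (auto simp: path_weight_def)
    with sum_path_weight[OF assms] show False by simp
  qed
  moreover have "total_weight l \<ge> 0"
    unfolding total_weight_def by (intro sum_nonneg edge_product_a_nonneg)
  ultimately show ?thesis by simp
qed

section \<open>The two divergences\<close>

lemma paths_relative_entropy_defined:
  assumes l: "l \<ge> 1"
  shows "relative_entropy_defined (seqs l) path_weight (\<lambda>p. edge_product a p / total_weight l)"
  unfolding relative_entropy_defined_def prob_vector_def
proof (intro conjI ballI impI)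
  note Z = total_weight_pos[OF l]
  show "0 \<le> edge_product a p / total_weight l" if "p \<in> seqs l" for p
    using edge_product_a_nonneg[OF that] Z by simp
  show "(\<Sum>p\<in>seqs l. edge_product a p / total_weight l) = 1"
    using Z by (simp flip: sum_divide_distrib total_weight_def)
  show "0 < edge_product a p / total_weight l" if "p \<in> seqs l" "path_weight p > 0" for p
    using edge_product_a_nonneg[OF that(1)] that(2) Z by (cases "edge_product a p = 0") (auto simp: path_weight_def)
qed (use path_weight_nonneg l finite_seqs sum_path_weight in auto)

text \<open>
  The density is \<open>total_weight l * x (hd p) * x (last p) / lam ^ (l - 1)\<close>; each endpoint contributes
  the mean of \<open>log x\<close> under the stationary distribution.
\<close>
lemma relative_entropy_paths:
  assumes l: "l \<ge> 1"
  shows "relative_entropy (seqs l) path_weight (\<lambda>p. edge_product a p / total_weight l) =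
    log 2 (total_weight l) - (real l - 1) * log 2 lam + 2 * (\<Sum>v\<in>V. (x v)\<^sup>2 * log 2 (x v))"
proof -
  note Z = total_weight_pos[OF l]
  obtain n where n: "l = Suc n" using l by (cases l) auto
  define c where "c = log 2 (total_weight l) - (real l - 1) * log 2 lam"
  have "path_weight p * log 2 (path_weight p / (edge_product a p / total_weight l)) =
      path_weight p * c + path_weight p * log 2 (x (hd p)) + path_weight p * log 2 (x (last p))"
    if p: "p \<in> seqs l" for p
  proof (cases "edge_product a p = 0")
    case True
    then show ?thesis by (simp add: path_weight_def)
  next
    case False
    have pos: "x (hd p) > 0" "x (last p) > 0"
      using hd_last_in_V[OF p l] by (auto intro: x_pos)
    have "path_weight p / (edge_product a p / total_weight l) =
        total_weight l * x (hd p) * x (last p) / lam ^ n"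
      using False p n by (simp add: path_weight_def)
    then have "log 2 (path_weight p / (edge_product a p / total_weight l)) =
        c + log 2 (x (hd p)) + log 2 (x (last p))"
      using pos Z lam_pos by (simp add: log_divide log_mult log_nat_power c_def n)
    then show ?thesis by (simp add: algebra_simps)
  qed
  then have "relative_entropy (seqs l) path_weight (\<lambda>p. edge_product a p / total_weight l) =
      sum path_weight (seqs l) * c + (\<Sum>p\<in>seqs l. path_weight p * log 2 (x (hd p)))
        + (\<Sum>p\<in>seqs l. path_weight p * log 2 (x (last p)))"
    by (simp add: relative_entropy_eq_sum[OF paths_relative_entropy_defined[OF l]]
        sum.distrib sum_distrib_right)
  then show ?thesis
    using sum_path_weight_hd[where n = n and f = "\<lambda>v. log 2 (x v)"]
      sum_path_weight_last[where n = n and f = "\<lambda>v. log 2 (x v)"]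
      sum_path_weight[OF l]
    by (simp add: n c_def)
qed

definition edge_law :: "'a \<times> 'a \<Rightarrow> real" where
  "edge_law = (\<lambda>(u, v). a u v * x u * x v / lam)"

definition product_edge_law :: "'a \<times> 'a \<Rightarrow> real" where
  "product_edge_law = (\<lambda>(u, v). a u v * (x u)\<^sup>2 * (x v)\<^sup>2 / form)"

lemma sum_edge_law_fst: "(\<Sum>e\<in>V \<times> V. edge_law e * f (fst e)) = (\<Sum>v\<in>V. (x v)\<^sup>2 * f v)"
proof -
  have "(\<Sum>e\<in>V \<times> V. edge_law e * f (fst e)) =
      (\<Sum>u\<in>V. (\<Sum>v\<in>V. a u v * x v) * (x u / lam * f u))"
    unfolding sum_distrib_right sum.cartesian_product
    by (intro sum.cong) (auto simp: edge_law_def)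
  also have "\<dots> = (\<Sum>v\<in>V. (x v)\<^sup>2 * f v)"
    using lam_pos by (intro sum.cong) (auto simp: eigen power2_eq_square)
  finally show ?thesis .
qed

lemma sum_edge_law_snd: "(\<Sum>e\<in>V \<times> V. edge_law e * f (snd e)) = (\<Sum>v\<in>V. (x v)\<^sup>2 * f v)"
proof -
  have "(\<Sum>e\<in>V \<times> V. edge_law e * f (snd e)) = (\<Sum>u\<in>V. \<Sum>v\<in>V. edge_law (u, v) * f v)"
    by (simp add: sum.cartesian_product case_prod_unfold)
  also have "\<dots> = (\<Sum>v\<in>V. \<Sum>u\<in>V. edge_law (u, v) * f v)"
    by (rule sum.swap)
  also have "\<dots> = (\<Sum>v\<in>V. \<Sum>u\<in>V. edge_law (v, u) * f v)"
    by (intro sum.cong refl) (simp add: edge_law_def a_sym mult_ac)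
  also have "\<dots> = (\<Sum>e\<in>V \<times> V. edge_law e * f (fst e))"
    by (simp add: sum.cartesian_product case_prod_unfold)
  finally show ?thesis by (simp add: sum_edge_law_fst)
qed

lemma sum_edge_law: "sum edge_law (V \<times> V) = 1"
  using sum_edge_law_fst[of "\<lambda>_. 1"] by (simp add: x_norm)

lemma edge_law_nonneg: "e \<in> V \<times> V \<Longrightarrow> edge_law e \<ge> 0"
  using a_nonneg x_pos lam_pos
  by (auto simp: edge_law_def less_imp_le intro!: divide_nonneg_nonneg mult_nonneg_nonneg)

lemma form_eq_sum: "form = (\<Sum>(u, v)\<in>V \<times> V. a u v * (x u)\<^sup>2 * (x v)\<^sup>2)"
  by (simp add: form_def sum.cartesian_product)

lemma form_pos: "form > 0"
proof -
  have nn: "0 \<le> (case e of (u, v) \<Rightarrow> a u v * (x u)\<^sup>2 * (x v)\<^sup>2)" if "e \<in> V \<times> V" for e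
    using that a_nonneg by (auto intro!: mult_nonneg_nonneg)
  have "form \<noteq> 0"
  proof
    assume "form = 0"
    then have "\<forall>e\<in>V \<times> V. (case e of (u, v) \<Rightarrow> a u v * (x u)\<^sup>2 * (x v)\<^sup>2) = 0"
      using nn finite_V unfolding form_eq_sum by (subst (asm) sum_nonneg_eq_0_iff) auto
    then have "sum edge_law (V \<times> V) = 0"
      by (intro sum.neutral) (force simp: edge_law_def)
    then show False by (simp add: sum_edge_law)
  qed
  moreover have "form \<ge> 0"
    unfolding form_eq_sum using nn by (rule sum_nonneg)
  ultimately show ?thesis by simp
qed

lemma edges_relative_entropy_defined:
  "relative_entropy_defined (V \<times> V) edge_law product_edge_law"
  unfolding relative_entropy_defined_def prob_vector_def
proof (intro conjI ballI impI)
  show "sum product_edge_law (V \<times> V) = 1"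
    using form_pos form_eq_sum
    by (simp add: product_edge_law_def case_prod_unfold flip: sum_divide_distrib)
  fix e assume e: "e \<in> V \<times> V"
  then obtain u v where uv: "e = (u, v)" "u \<in> V" "v \<in> V" by auto
  note pos = form_pos lam_pos x_pos[OF uv(2)] x_pos[OF uv(3)]
  show "product_edge_law e \<ge> 0"
    using pos a_nonneg[OF uv(2,3)] by (simp add: product_edge_law_def uv(1))
  show "product_edge_law e > 0" if "edge_law e > 0"
    using that pos
    by (auto simp: product_edge_law_def edge_law_def uv(1) zero_less_mult_iff zero_less_divide_iff)
qed (use edge_law_nonneg sum_edge_law finite_V in auto)

text \<open>The density is \<open>form / (lam * x u * x v)\<close>, and both marginals are the square of \<open>x\<close>.\<close>
lemma relative_entropy_edges:
  "relative_entropy (V \<times> V) edge_law product_edge_law =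
    log 2 form - log 2 lam - 2 * (\<Sum>v\<in>V. (x v)\<^sup>2 * log 2 (x v))"
proof -
  define c where "c = log 2 form - log 2 lam"
  have "edge_law e * log 2 (edge_law e / product_edge_law e) =
      edge_law e * c - edge_law e * log 2 (x (fst e)) - edge_law e * log 2 (x (snd e))"
    if e: "e \<in> V \<times> V" for e
  proof -
    from e obtain u v where uv: "e = (u, v)" "u \<in> V" "v \<in> V" by auto
    note pos = form_pos lam_pos x_pos[OF uv(2)] x_pos[OF uv(3)]
    show ?thesis
    proof (cases "a u v = 0")
      case True
      then show ?thesis by (simp add: edge_law_def uv(1))
    next
      case False
      then have "edge_law e / product_edge_law e = form / (lam * x u * x v)"
        using pos by (simp add: edge_law_def product_edge_law_def uv(1) field_simps power2_eq_square)
      then have "log 2 (edge_law e / product_edge_law e) = c - log 2 (x u) - log 2 (x v)"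
        using pos by (simp add: log_divide log_mult c_def)
      then show ?thesis by (simp only: uv(1) fst_conv snd_conv right_diff_distrib)
    qed
  qed
  then have "relative_entropy (V \<times> V) edge_law product_edge_law =
      sum edge_law (V \<times> V) * c - (\<Sum>e\<in>V \<times> V. edge_law e * log 2 (x (fst e)))
        - (\<Sum>e\<in>V \<times> V. edge_law e * log 2 (x (snd e)))"
    by (simp add: relative_entropy_eq_sum[OF edges_relative_entropy_defined]
        sum_subtractf sum_distrib_right)
  then show ?thesis
    using sum_edge_law_fst[of "\<lambda>v. log 2 (x v)"] sum_edge_law_snd[of "\<lambda>v. log 2 (x v)"]
    by (simp add: sum_edge_law c_def)
qed

section \<open>The law of the chain\<close>

text \<open>
  Conditioning on the history is possible only if the history has positive probability; if it is a
  null event, so is each of its continuations, and the product formula holds with both sides zero.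
\<close>
lemma path_law_snoc:
  assumes chain: "markov_chain M V init P X" and p: "p \<noteq> []" and v: "v \<in> V"
  shows "path_law M X (length p + 1) (p @ [v]) = path_law M X (length p) p * P (last p) v"
proof -
  interpret prob_space M using chain by (simp add: markov_chain_def)
  define t where "t = length p"
  have t: "t \<ge> 1" using p by (cases p) (auto simp: t_def)
  \<comment> \<open>time starts at 1, positions in a list at 0\<close>
  define h where "h i = p ! (i - 1)" for i
  have ht: "h t = last p" using p by (simp add: h_def t_def last_conv_nth)
  let ?H = "\<lambda>\<omega>. \<forall>i\<in>{1..t}. X i \<omega> = h i"
  have H_iff: "map (\<lambda>i. X i \<omega>) [1..<t + 1] = p \<longleftrightarrow> ?H \<omega>" for \<omega>
  proof -
    have "map (\<lambda>i. X i \<omega>) [1..<t + 1] = p \<longleftrightarrow> (\<forall>j<t. X (Suc j) \<omega> = p ! j)"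
      by (subst list_eq_iff_nth_eq) (simp add: t_def del: upt_Suc)
    also have "\<dots> \<longleftrightarrow> ?H \<omega>"
    proof safe
      fix i assume "\<forall>j<t. X (Suc j) \<omega> = p ! j" "i \<in> {1..t}"
      then show "X i \<omega> = h i" by (cases i) (auto simp: h_def)
    next
      fix j assume "?H \<omega>" "j < t"
      then have "X (Suc j) \<omega> = h (Suc j)" by simp
      then show "X (Suc j) \<omega> = p ! j" by (simp add: h_def)
    qed
    finally show ?thesis .
  qed
  have law: "path_law M X (length p) p = \<P>(\<omega> in M. ?H \<omega>)"
    unfolding path_law_def t_def[symmetric] H_iff ..
  have law': "path_law M X (length p + 1) (p @ [v]) = \<P>(\<omega> in M. X (t + 1) \<omega> = v \<and> ?H \<omega>)"
    unfolding path_law_def t_def[symmetric] using H_iff t by (simp add: conj_commute)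
  show ?thesis
  proof (cases "\<P>(\<omega> in M. ?H \<omega>) > 0")
    case True
    then have "\<P>(\<omega> in M. X (t + 1) \<omega> = v \<bar> ?H \<omega>) = P (h t) v"
      using chain t v unfolding markov_chain_def by blast
    with True show ?thesis
      unfolding law law' by (simp add: cond_prob_def ht field_simps)
  next
    case False
    have X: "X i \<in> measurable M (count_space V)" if "i \<ge> 1" for i
      using chain that by (simp add: markov_chain_def)
    have "{\<omega> \<in> space M. X i \<omega> = w} \<in> events" if "i \<ge> 1" for i w
    proof -
      have "{\<omega> \<in> space M. X i \<omega> = w} = X i -` ({w} \<inter> V) \<inter> space M"
        using measurable_space[OF X[OF that]] by auto
      then show ?thesis using measurable_sets[OF X[OF that], of "{w} \<inter> V"] by simp
    qed
    then have "{\<omega> \<in> space M. ?H \<omega>} \<in> events"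
      by (intro sets.sets_Collect_finite_All) auto
    then have "\<P>(\<omega> in M. X (t + 1) \<omega> = v \<and> ?H \<omega>) \<le> \<P>(\<omega> in M. ?H \<omega>)"
      by (intro finite_measure_mono) auto
    with False show ?thesis
      unfolding law law' by (simp add: not_less measure_le_0_iff)
  qed
qed

lemma path_law_eq_path_weight:
  assumes chain: "markov_chain M V (\<lambda>v. (x v)\<^sup>2) (\<lambda>u v. a u v * x v / (lam * x u)) X"
    and "p \<noteq> []" "set p \<subseteq> V"
  shows "path_law M X (length p) p = path_weight p"
  using assms(2,3)
proof (induction p rule: rev_nonempty_induct)
  case (single v)
  then have "\<P>(\<omega> in M. X 1 \<omega> = v) = (x v)\<^sup>2"
    using chain by (simp add: markov_chain_def)
  then show ?case
    by (simp add: path_law_def path_weight_single)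
next
  case (snoc v p)
  then show ?case
    using path_law_snoc[OF chain snoc.hyps, of v] by (simp add: path_weight_snoc)
qed

text \<open>The chain takes values in \<open>V\<close> at every point of the sample space, so the event is empty.\<close>
lemma path_law_outside:
  assumes chain: "markov_chain M V init P X" and "p \<notin> seqs l"
  shows "path_law M X l p = 0"
proof -
  have "X i \<omega> \<in> V" if "i \<ge> 1" "\<omega> \<in> space M" for i \<omega>
    using chain that measurable_space[of "X i" M "count_space V" \<omega>] by (auto simp: markov_chain_def)
  then have "{\<omega> \<in> space M. map (\<lambda>t. X t \<omega>) [1..<l + 1] = p} = {}"
    using assms(2) by auto
  then show ?thesis by (simp only: path_law_def measure_empty)
qed

end

section \<open>Walks in a graph\<close>

lemma (in pair_graph) positive_eigenvector_perron:
  assumes "perron_vector G x" and "parcs G \<noteq> {}"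
  shows "positive_eigenvector (pverts G) (adj G) (graph_spectral_radius G) x"
proof
  show "finite (pverts G)" by (rule pair_finite_verts)
  show "adj G u v = adj G v u" for u v
    using pair_sym_arcs by (auto simp: adj_def symmetric_def elim: symE)
  show eigen: "(\<Sum>v\<in>pverts G. adj G u v * x v) = graph_spectral_radius G * x u"
    if "u \<in> pverts G" for u
    using assms(1) that by (simp add: perron_vector_def)
  show pos: "x v > 0" if "v \<in> pverts G" for v
    using assms(1) that by (simp add: perron_vector_def)
  show "(\<Sum>v\<in>pverts G. (x v)\<^sup>2) = 1"
    using assms(1) by (simp add: perron_vector_def)
  \<comment> \<open>the eigenvalue equation at an endpoint of an edge has a positive left-hand side\<close>
  obtain u v where uv: "(u, v) \<in> parcs G" using assms(2) by auto
  then have V: "u \<in> pverts G" "v \<in> pverts G" by (auto dest: in_arcsD1 in_arcsD2)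
  have "0 < (\<Sum>v\<in>pverts G. adj G u v * x v)"
    using uv V pos pair_finite_verts
    by (intro sum_pos2[of _ v]) (auto simp: adj_def less_imp_le)
  then show "graph_spectral_radius G > 0"
    using pos[OF V(1)] by (simp add: eigen[OF V(1)] zero_less_mult_iff)
qed (simp add: adj_def)

lemma edge_product_adj:
  "edge_product (adj G) p = (if set (vwalk_arcs p) \<subseteq> parcs G then 1 else 0)"
  by (induction p rule: vwalk_arcs.induct) (auto simp: adj_def)

lemma edge_product_adj_eq_indicator_walks:
  assumes "p \<in> vertex_seqs G l" "l \<ge> 1"
  shows "edge_product (adj G) p = indicator (walks G l) p"
  using assms by (auto simp: edge_product_adj walks_def vwalk_def vertex_seqs_def indicator_def)

lemma walks_subset_vertex_seqs: "walks G l \<subseteq> vertex_seqs G l"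
  by (auto simp: walks_def vwalk_def vertex_seqs_def)

theorem theorem3p1:
  fixes G :: "'a pair_pre_digraph"
    and lam :: real
    and x \<pi> :: "'a \<Rightarrow> real"
    and P :: "'a \<Rightarrow> 'a \<Rightarrow> real"
    and M :: "'b measure"
    and X :: "nat \<Rightarrow> 'b \<Rightarrow> 'a"
    and \<mu> \<nu> :: "nat \<Rightarrow> 'a list \<Rightarrow> real"
    and Q R :: "'a \<times> 'a \<Rightarrow> real"
    and l :: nat
  assumes "pair_graph G"
    and "Digraph_Component.connected (with_proj G)"
    and "parcs G \<noteq> {}"
    and "lam = graph_spectral_radius G"
    and "perron_vector G x"
    and "\<pi> = (\<lambda>v. (x v)\<^sup>2)"
    and "P = (\<lambda>u v. adj G u v * x v / (lam * x u))"
    and "markov_chain M (pverts G) \<pi> P X"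
    and "\<mu> = (\<lambda>k. path_law M X k)"
    and "\<nu> = (\<lambda>k. pmf (pmf_of_set (walks G k)))"
    and "Q = (\<lambda>(u, v). adj G u v * x u * x v / lam)"
    and "R = (\<lambda>(u, v). adj G u v * \<pi> u * \<pi> v / edge_form G \<pi>)"
    and "l \<ge> 1"
  shows "relative_entropy_defined (pverts G \<times> pverts G) Q R \<and>
    relative_entropy_defined (vertex_seqs G l) (\<mu> l) (\<nu> l) \<and>
    log 2 (real (num_walks G l)) =
      real l * log 2 lam - log 2 (edge_form G \<pi>)
      + relative_entropy (pverts G \<times> pverts G) Q R
      + relative_entropy (vertex_seqs G l) (\<mu> l) (\<nu> l) \<and>
    lam ^ l \<le> edge_form G \<pi> * real (num_walks G l) \<and>
    (lam ^ l = edge_form G \<pi> * real (num_walks G l) \<longleftrightarrow> Q = R \<and> \<mu> l = \<nu> l)"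
proof -
  interpret G: pair_graph G by (rule assms(1))
  interpret positive_eigenvector "pverts G" "adj G" lam x
    unfolding assms(4) by (rule G.positive_eigenvector_perron[OF assms(5,3)])
  note l = \<open>l \<ge> 1\<close>
  have seqs: "vertex_seqs G l = seqs l" by (simp add: vertex_seqs_def)
  have chain: "markov_chain M (pverts G) (\<lambda>v. (x v)\<^sup>2)
      (\<lambda>u v. adj G u v * x v / (lam * x u)) X"
    using assms(6-8) by simp
  have Phi: "edge_form G \<pi> = form"
    by (simp add: edge_form_def form_def assms(6))
  have Q: "Q = edge_law" and R: "R = product_edge_law"
    by (simp_all add: assms(6,11,12) edge_law_def product_edge_law_def Phi[unfolded assms(6)])

  have fin: "finite (walks G l)"
    using finite_subset[OF walks_subset_vertex_seqs] finite_seqs seqs by metis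
  have w: "real (num_walks G l) = total_weight l"
  proof -
    have "total_weight l = (\<Sum>p\<in>vertex_seqs G l. indicator (walks G l) p)"
      unfolding total_weight_def seqs
      by (intro sum.cong refl edge_product_adj_eq_indicator_walks l) (simp add: seqs)
    also have "\<dots> = real (card (vertex_seqs G l \<inter> walks G l))"
      using finite_seqs[of l] by (simp add: seqs indicator_def sum.If_cases)
    also have "vertex_seqs G l \<inter> walks G l = walks G l"
      using walks_subset_vertex_seqs by auto
    finally show ?thesis by (simp add: num_walks_def)
  qed
  have w_pos: "real (num_walks G l) > 0" using total_weight_pos[OF l] by (simp add: w)
  have ne: "walks G l \<noteq> {}" using w_pos by (auto simp: num_walks_def)

  have mu: "\<mu> l p = path_weight p" if "p \<in> seqs l" for p
    using path_law_eq_path_weight[OF chain, of p] that l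
    by (cases "p = []") (auto simp: assms(9))
  have mu_out: "\<mu> l p = 0" if "p \<notin> seqs l" for p
    using path_law_outside[OF chain that] by (simp add: assms(9))
  have nu: "\<nu> l p = edge_product (adj G) p / total_weight l" if "p \<in> seqs l" for p
    using edge_product_adj_eq_indicator_walks[of p G l] that l fin ne
    by (simp add: assms(10) seqs w[symmetric] num_walks_def)
  have nu_out: "\<nu> l p = 0" if "p \<notin> seqs l" for p
    using walks_subset_vertex_seqs[of G l] that fin ne
    by (auto simp: assms(10) seqs indicator_def)

  have def_e: "relative_entropy_defined (pverts G \<times> pverts G) Q R"
    unfolding Q R by (rule edges_relative_entropy_defined)
  have def_p: "relative_entropy_defined (vertex_seqs G l) (\<mu> l) (\<nu> l)"
    using paths_relative_entropy_defined[OF l] unfolding seqs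
    by (simp add: relative_entropy_defined_def prob_vector_def mu nu)
  have ent_p: "relative_entropy (vertex_seqs G l) (\<mu> l) (\<nu> l) =
      relative_entropy (seqs l) path_weight (\<lambda>p. edge_product (adj G) p / total_weight l)"
    unfolding seqs relative_entropy_eq_sum[OF def_p[unfolded seqs]]
      relative_entropy_eq_sum[OF paths_relative_entropy_defined[OF l]]
    by (intro sum.cong refl) (simp only: mu nu)
  have identity: "log 2 (real (num_walks G l)) = real l * log 2 lam - log 2 (edge_form G \<pi>)
      + relative_entropy (pverts G \<times> pverts G) Q R
      + relative_entropy (vertex_seqs G l) (\<mu> l) (\<nu> l)"
    unfolding ent_p relative_entropy_paths[OF l] Q R relative_entropy_edges Phi w
    by (simp add: algebra_simps)

  have log_ratio: "log 2 (edge_form G \<pi> * real (num_walks G l)) - log 2 (lam ^ l) =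
      relative_entropy (pverts G \<times> pverts G) Q R + relative_entropy (vertex_seqs G l) (\<mu> l) (\<nu> l)"
    using identity form_pos w_pos lam_pos by (simp add: Phi log_mult log_nat_power)
  have pos: "edge_form G \<pi> * real (num_walks G l) > 0" "lam ^ l > 0"
    using form_pos w_pos lam_pos by (simp_all add: Phi)
  note nonneg = relative_entropy_nonneg[OF def_e] relative_entropy_nonneg[OF def_p]
  have "log 2 (lam ^ l) \<le> log 2 (edge_form G \<pi> * real (num_walks G l))"
    using log_ratio nonneg by linarith
  then have ineq: "lam ^ l \<le> edge_form G \<pi> * real (num_walks G l)"
    using pos by simp

  \<comment> \<open>all four functions vanish off the sets on which the divergences compare them\<close>
  have eq_e: "Q = R \<longleftrightarrow> (\<forall>e\<in>pverts G \<times> pverts G. Q e = R e)"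
  proof -
    have "Q e = R e" if "e \<notin> pverts G \<times> pverts G" for e
      using that by (auto simp: assms(11,12) adj_def split: prod.split
          dest: G.in_arcsD1 G.in_arcsD2)
    then show ?thesis by (auto simp: fun_eq_iff)
  qed
  have eq_p: "\<mu> l = \<nu> l \<longleftrightarrow> (\<forall>p\<in>vertex_seqs G l. \<mu> l p = \<nu> l p)"
    unfolding fun_eq_iff seqs using mu_out nu_out by (metis (lifting))
  have "lam ^ l = edge_form G \<pi> * real (num_walks G l) \<longleftrightarrow>
      log 2 (lam ^ l) = log 2 (edge_form G \<pi> * real (num_walks G l))"
    using pos by (auto simp: log_def)
  also have "\<dots> \<longleftrightarrow> relative_entropy (pverts G \<times> pverts G) Q R = 0 \<and>
      relative_entropy (vertex_seqs G l) (\<mu> l) (\<nu> l) = 0"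
    using log_ratio nonneg by linarith
  also have "\<dots> \<longleftrightarrow> Q = R \<and> \<mu> l = \<nu> l"
    unfolding eq_e eq_p relative_entropy_eq_0_iff[OF def_e] relative_entropy_eq_0_iff[OF def_p] ..
  finally show ?thesis
    using def_e def_p identity ineq by blast
qed

end
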